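(* Let $d\ge 2$ be an integer, let $\alpha>0$, and let $X_1,X_2,\ldots$ be the random sequence of points in $\mathbb{R}^d$ generated by the growing cluster process with parameter $\alpha$. Then, almost surely, the convex hull of the point set $\mathcal{X}_\infty=\{X_1,X_2,\ldots\}$ is bounded.
   Context: Growing cluster process with parameter $\alpha>0$ in $\mathbb{R}^d$, $d\ge 2$: set $X_1=0$ (the origin). For each $i\geq 2$, choose $j$ uniformly at random from $[i-1]=\{1,2,\ldots,i-1\}$ and let $X_i=X_j+D_i$, where $D_i=(\delta_1,\ldots,\delta_d)$ and $\delta_1,\ldots,\delta_d$ are independent copies of the Normal distribution $N(0,\sigma_i)$ with mean $0$ and standard deviation $\sigma_i=i^{-\alpha}$. All random choices (the uniform indices and the Gaussian vectors, over all $i$) are mutually independent. *)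

theory Defs
  imports "HOL-Probability.Probability"
begin

text \<open>
  \<open>J i\<close> is the random parent index of the \<open>i\<close>-th point and \<open>\<delta> i k\<close> the \<open>k\<close>-th coordinate of its
  displacement. Points are numbered from 1, so \<open>X 0\<close> is unconstrained and must not be counted as
  a point of the cluster; likewise only \<open>J i\<close> and \<open>\<delta> i\<close> with \<open>i \<ge> 2\<close> matter.
  In \<open>independent\<close>, the indices are viewed as reals only because \<open>indep_vars\<close> requires a common
  value type; \<open>real\<close> being injective, the generated \<open>\<sigma>\<close>-algebras are those of the \<open>J i\<close>.
  The second parameter of \<open>normal_density\<close> is the standard deviation.
\<close>

locale growing_cluster_process = prob_space M
  for M :: "'a measure" +
  fixes \<alpha> :: real
    and J :: "nat \<Rightarrow> 'a \<Rightarrow> nat"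
    and \<delta> :: "nat \<Rightarrow> 'n::finite \<Rightarrow> 'a \<Rightarrow> real"
    and X :: "nat \<Rightarrow> 'a \<Rightarrow> real ^ 'n"
  assumes parent_measurable: "\<And>i. 2 \<le> i \<Longrightarrow> J i \<in> measurable M (count_space UNIV)"
    and parent_uniform:
      "\<And>i. 2 \<le> i \<Longrightarrow> distr M (count_space UNIV) (J i) = measure_pmf (pmf_of_set {1..i - 1})"
    and step_normal:
      "\<And>i k. 2 \<le> i \<Longrightarrow> distributed M lborel (\<delta> i k) (normal_density 0 (real i powr (- \<alpha>)))"
    and independent:
      "indep_vars (\<lambda>_. borel)
         (\<lambda>s. case s of Inl i \<Rightarrow> (\<lambda>\<omega>. real (J i \<omega>)) | Inr (i, k) \<Rightarrow> \<delta> i k)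
         ({2..} <+> ({2..} \<times> UNIV))"
    and X_first: "\<And>\<omega>. \<omega> \<in> space M \<Longrightarrow> X 1 \<omega> = 0"
    and X_step: "\<And>i \<omega>. 2 \<le> i \<Longrightarrow> \<omega> \<in> space M \<Longrightarrow> X i \<omega> = X (J i \<omega>) \<omega> + (\<chi> k. \<delta> i k \<omega>)"

end

theory Submission
  imports Defs
begin

text \<open>
  The parent indices \<open>J i\<close> make the points into a random recursive tree rooted at 1, and \<open>X i\<close> is
  the sum of the displacements along the path from the root to \<open>i\<close>. Let \<open>D\<^sub>i\<close> be the depth of
  \<open>i\<close>. It suffices to bound the displacement at \<open>i\<close> by a multiple of \<open>r ^ D\<^sub>i\<close> for some \<open>r < 1\<close>:
  since the depth increases by one at each step of a path, every path sum is then dominated by a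
  geometric series. Two almost sure facts give such a bound, and each of them follows from a
  convergent series of expectations (\<open>AE_bounded_of_summable_integral\<close>).

  \<^item> The depth is at most logarithmic (\<open>AE_depth_bound\<close>). As \<open>D\<^sub>i = D\<^sub>j + 1\<close> with \<open>j = J i\<close> uniform
    and independent of the tree on \<open>1, ..., i - 1\<close>, the numbers \<open>e\<^sub>i = E 2 ^ D\<^sub>i\<close> satisfy
    \<open>e\<^sub>i = 2 / (i - 1) * (e\<^sub>1 + ... + e\<^sub>i\<^sub>-\<^sub>1)\<close> with \<open>e\<^sub>1 = 1\<close>, whence \<open>e\<^sub>i = i\<close>. So the sum of
    \<open>2 ^ D\<^sub>i / i ^ 3\<close> has finite mean, and almost surely \<open>2 ^ D\<^sub>i \<le> C * i ^ 3\<close> for all \<open>i\<close>.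
  \<^item> The displacements decay polynomially (\<open>AE_step_bound\<close>). The \<open>2m\<close>-th moment of
    \<open>i powr (\<alpha> / 2) * \<delta> i k\<close> is a multiple of \<open>i powr (- m * \<alpha>)\<close>, which is summable once
    \<open>m * \<alpha> > 1\<close>. Hence almost surely \<open>\<bar>\<delta> i k\<bar> \<le> C * i powr (- \<alpha> / 2)\<close> for all \<open>i\<close>.

  Inserting the first bound into the second one yields \<open>r = 2 powr (- \<alpha> / 6)\<close>.
\<close>

section \<open>Depth in a recursive tree\<close>

text \<open>
  The number of edges between a node \<open>i\<close> and the root 1, where \<open>p\<close> is the parent function and
  \<open>1 \<le> p m < m\<close> for \<open>m \<ge> 2\<close>. The guard
  \<open>p i < i\<close> makes the recursion terminate for arbitrary \<open>p\<close>, and \<open>2 \<le> i\<close> ensures that only the values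
  of \<open>p\<close> from 2 on matter.
\<close>

function depth :: "(nat \<Rightarrow> nat) \<Rightarrow> nat \<Rightarrow> nat" where
  "depth p i = (if 2 \<le> i \<and> p i < i then Suc (depth p (p i)) else 0)"
  by auto
termination
  by (relation "Wellfounded.measure snd") auto

declare depth.simps [simp del]

lemma depth_root: "depth p (Suc 0) = 0"
  by (subst depth.simps) simp

lemma depth_step: "2 \<le> i \<Longrightarrow> p i < i \<Longrightarrow> depth p i = Suc (depth p (p i))"
  by (subst depth.simps) simp

lemma depth_le: "depth p i \<le> i"
proof (induction i rule: less_induct)
  case (less i)
  show ?case
  proof (cases "2 \<le> i \<and> p i < i")
    case True
    with less[of "p i"] show ?thesis
      by (simp add: depth_step)
  next
    case False
    then show ?thesis
      by (subst depth.simps) auto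
  qed
qed

lemma depth_cong:
  assumes "\<And>m. 2 \<le> m \<Longrightarrow> m \<le> i \<Longrightarrow> p m = q m"
  shows "depth p i = depth q i"
  using assms
proof (induction i rule: less_induct)
  case (less i)
  show ?case
  proof (cases "2 \<le> i \<and> p i < i")
    case True
    then have "depth p (p i) = depth q (p i)"
      using less.prems by (intro less.IH) auto
    with True less.prems[of i] show ?thesis
      by (simp add: depth_step)
  next
    case False
    moreover have "\<not> (2 \<le> i \<and> q i < i)"
      using False less.prems[of i] by auto
    ultimately show ?thesis
      by (subst (1 2) depth.simps) (simp only: if_False)
  qed
qed

text \<open>
  The product of finitely many discrete countable spaces is discrete, so every function on it is
  measurable.
\<close>

lemma measurable_depth_PiM:
  assumes "j \<le> i"
  shows "(\<lambda>p. depth p j) \<in> measurable (PiM {2..i} (\<lambda>_. count_space UNIV)) (count_space UNIV)"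
  by (subst count_space_PiM_finite) auto

section \<open>Almost sure bounds from summable means\<close>

lemma AE_bounded_of_summable_integral:
  fixes Y :: "nat \<Rightarrow> 'a \<Rightarrow> real"
  assumes int: "\<And>i. integrable M (Y i)"
    and nonneg: "\<And>i \<omega>. 0 \<le> Y i \<omega>"
    and sum: "summable (\<lambda>i. \<integral>\<omega>. Y i \<omega> \<partial>M)"
  shows "AE \<omega> in M. \<exists>C. \<forall>i. Y i \<omega> \<le> C"
proof -
  have [measurable]: "Y i \<in> borel_measurable M" for i
    using int by auto
  have "(\<integral>\<^sup>+\<omega>. (\<Sum>i. ennreal (Y i \<omega>)) \<partial>M) = (\<Sum>i. \<integral>\<^sup>+\<omega>. ennreal (Y i \<omega>) \<partial>M)"
    by (rule nn_integral_suminf) simp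
  also have "\<dots> = (\<Sum>i. ennreal (\<integral>\<omega>. Y i \<omega> \<partial>M))"
    using int nonneg by (simp add: nn_integral_eq_integral)
  also have "\<dots> \<noteq> \<infinity>"
    using sum nonneg by (simp add: suminf_ennreal2)
  finally have "AE \<omega> in M. (\<Sum>i. ennreal (Y i \<omega>)) \<noteq> \<infinity>"
    by (intro nn_integral_PInf_AE) auto
  then show ?thesis
  proof eventually_elim
    case (elim \<omega>)
    have "ennreal (Y i \<omega>) \<le> (\<Sum>i. ennreal (Y i \<omega>))" for i
      using sum_le_suminf[of "\<lambda>i. ennreal (Y i \<omega>)" "{i}"] by simp
    then have "Y i \<omega> \<le> enn2real (\<Sum>i. ennreal (Y i \<omega>))" for i
      using elim nonneg[of i \<omega>] by (metis enn2real_ennreal enn2real_mono infinity_ennreal_def less_top)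
    then show ?case by blast
  qed
qed

section \<open>Depth of the random recursive tree\<close>

context growing_cluster_process
begin

lemma prob_parent_eq:
  assumes "2 \<le> i" "1 \<le> j" "j < i"
  shows "prob {\<omega> \<in> space M. J i \<omega> = j} = 1 / (real i - 1)"
proof -
  note parent_measurable[OF assms(1), measurable]
  have "prob {\<omega> \<in> space M. J i \<omega> = j} = measure (distr M (count_space UNIV) (J i)) {j}"
    by (subst measure_distr) (auto intro!: arg_cong[where f = prob])
  also have "\<dots> = 1 / (real i - 1)"
    using assms by (simp add: parent_uniform pmf_of_set measure_pmf_single of_nat_diff)
  finally show ?thesis .
qed

lemma AE_parent:
  assumes "2 \<le> i"
  shows "AE \<omega> in M. 1 \<le> J i \<omega> \<and> J i \<omega> < i"
proof -
  note parent_measurable[OF assms, measurable]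
  have "AE j in distr M (count_space UNIV) (J i). 1 \<le> j \<and> j < i"
    using assms unfolding parent_uniform[OF assms]
    by (subst AE_measure_pmf_iff) auto
  then show ?thesis
    by (subst (asm) AE_distr_iff) auto
qed

text \<open>The random depth of the node \<open>i\<close>, written \<open>D\<^sub>i\<close> above.\<close>

abbreviation node_depth :: "nat \<Rightarrow> 'a \<Rightarrow> nat" where
  "node_depth i \<omega> \<equiv> depth (\<lambda>m. J m \<omega>) i"

lemma measurable_node_depth [measurable]: "node_depth i \<in> measurable M (count_space UNIV)"
proof -
  have "(\<lambda>\<omega>. restrict (\<lambda>m. J m \<omega>) {2..i}) \<in> measurable M (PiM {2..i} (\<lambda>_. count_space UNIV))"
    using parent_measurable by (intro measurable_restrict) auto
  from measurable_compose[OF this measurable_depth_PiM[of i i]]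
  have "(\<lambda>\<omega>. depth (restrict (\<lambda>m. J m \<omega>) {2..i}) i) \<in> measurable M (count_space UNIV)"
    by simp
  moreover have "depth (restrict (\<lambda>m. J m \<omega>) {2..i}) i = node_depth i \<omega>" for \<omega>
    by (rule depth_cong) auto
  ultimately show ?thesis
    by simp
qed

lemma integrable_depth: "integrable M (\<lambda>\<omega>. 2 ^ node_depth i \<omega> :: real)"
  by (rule integrable_const_bound[where B = "2 ^ i"])
    (auto intro!: power_increasing depth_le)

text \<open>The depth of \<open>j\<close> is a function of the parents of \<open>2, ..., j\<close> only.\<close>

lemma indep_parent_depth:
  assumes "2 \<le> i" "j < i"
  shows "indep_var borel (\<lambda>\<omega>. indicator {j} (J i \<omega>) :: real) borel (\<lambda>\<omega>. 2 ^ node_depth j \<omega> :: real)"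
proof -
  \<comment> \<open>The parent indices occur in the independent family as reals and are recovered by rounding.\<close>
  let ?Z = "\<lambda>s. case s of Inl i \<Rightarrow> (\<lambda>\<omega>. real (J i \<omega>)) | Inr (i, k) \<Rightarrow> \<delta> i k"
  let ?A = "{Inl i} :: (nat + nat \<times> 'n) set" and ?B = "Inl ` {2..j} :: (nat + nat \<times> 'n) set"
  have ind: "indep_var (PiM ?A (\<lambda>_. borel)) (\<lambda>\<omega>. restrict (\<lambda>s. ?Z s \<omega>) ?A)
      (PiM ?B (\<lambda>_. borel)) (\<lambda>\<omega>. restrict (\<lambda>s. ?Z s \<omega>) ?B)"
    using assms by (intro indep_var_restrict[OF independent]) auto
  have 1: "(\<lambda>g. indicator {real j} (g (Inl i)) :: real) \<in> borel_measurable (PiM ?A (\<lambda>_. borel))"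
    by measurable
  have "(\<lambda>g. restrict (\<lambda>m. nat \<lfloor>g (Inl m)\<rfloor>) {2..j})
      \<in> measurable (PiM ?B (\<lambda>_. borel :: real measure)) (PiM {2..j} (\<lambda>_. count_space UNIV))"
  proof (rule measurable_restrict)
    fix m assume "m \<in> {2..j}"
    then have [measurable]: "(\<lambda>g. g (Inl m)) \<in> measurable (PiM ?B (\<lambda>_. borel :: real measure)) borel"
      by (intro measurable_component_singleton) auto
    show "(\<lambda>g. nat \<lfloor>g (Inl m)\<rfloor>) \<in> measurable (PiM ?B (\<lambda>_. borel :: real measure)) (count_space UNIV)"
      by measurable
  qed
  from measurable_compose[OF this measurable_depth_PiM[OF order.refl]]
  have meas: "(\<lambda>g. depth (restrict (\<lambda>m. nat \<lfloor>g (Inl m)\<rfloor>) {2..j}) j)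
      \<in> measurable (PiM ?B (\<lambda>_. borel :: real measure)) (count_space UNIV)" .
  have 2: "(\<lambda>g. 2 ^ depth (restrict (\<lambda>m. nat \<lfloor>g (Inl m)\<rfloor>) {2..j}) j :: real)
      \<in> borel_measurable (PiM ?B (\<lambda>_. borel :: real measure))"
    by (rule measurable_compose[OF meas]) simp
  have "depth (restrict (\<lambda>m. nat \<lfloor>restrict (\<lambda>s. ?Z s \<omega>) ?B (Inl m)\<rfloor>) {2..j}) j = node_depth j \<omega>" for \<omega>
    by (rule depth_cong) auto
  moreover have "indicator {real j} (real n) = (indicator {j} n :: real)" for n
    by (auto simp: indicator_def)
  ultimately show ?thesis
    using indep_var_compose[OF ind 1 2] by (simp add: comp_def)
qed

text \<open>
  With base 2, the expectation at \<open>i\<close> is \<open>2 / (i - 1)\<close> times the sum of the earlier ones, and this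
  recursion has the solution \<open>i\<close>.
\<close>

lemma expectation_depth:
  assumes "1 \<le> i"
  shows "expectation (\<lambda>\<omega>. 2 ^ node_depth i \<omega>) = real i"
  using assms
proof (induction i rule: less_induct)
  case (less i)
  show ?case
  proof (cases "i = 1")
    case True
    then show ?thesis by (simp add: depth_root prob_space)
  next
    case False
    with less.prems have i: "2 \<le> i" by simp
    note parent_measurable[OF i, measurable]
    let ?f = "\<lambda>j \<omega>. indicator {j} (J i \<omega>) * 2 ^ node_depth j \<omega> :: real"
    have int: "integrable M (\<lambda>\<omega>. indicator {j} (J i \<omega>) :: real)" for j
      by (rule integrable_const_bound[where B = 1]) (auto simp: indicator_def)
    have ex: "integrable M (?f j)" "expectation (?f j) = real j / (real i - 1)" if j: "j \<in> {1..<i}" for j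
    proof -
      have ji: "j < i" using j by auto
      show "integrable M (?f j)"
        by (rule indep_var_integrable[OF indep_parent_depth[OF i ji] int integrable_depth])
      have "expectation (\<lambda>\<omega>. indicator {j} (J i \<omega>) :: real) = prob {\<omega> \<in> space M. J i \<omega> = j}"
      proof -
        have "expectation (\<lambda>\<omega>. indicator {j} (J i \<omega>) :: real) = expectation (indicator {\<omega> \<in> space M. J i \<omega> = j})"
          by (intro Bochner_Integration.integral_cong) (auto simp: indicator_def)
        then show ?thesis by simp
      qed
      with j show "expectation (?f j) = real j / (real i - 1)"
        using indep_var_lebesgue_integral[OF indep_parent_depth[OF i ji] int integrable_depth]
          less.IH[of j] prob_parent_eq[OF i, of j] by simp
    qed
    have "expectation (\<lambda>\<omega>. 2 ^ node_depth i \<omega>) = expectation (\<lambda>\<omega>. 2 * (\<Sum>j\<in>{1..<i}. ?f j \<omega>))"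
    proof (rule integral_cong_AE)
      show "AE \<omega> in M. 2 ^ node_depth i \<omega> = 2 * (\<Sum>j\<in>{1..<i}. ?f j \<omega>)"
        using AE_parent[OF i]
      proof eventually_elim
        case (elim \<omega>)
        have "(\<Sum>j\<in>{1..<i}. ?f j \<omega>) = (\<Sum>j\<in>{1..<i}. if J i \<omega> = j then 2 ^ node_depth j \<omega> else 0)"
          by (intro sum.cong) (auto simp: indicator_def)
        with elim i show ?case by (simp add: depth_step)
      qed
    qed (auto intro!: borel_measurable_times borel_measurable_sum borel_measurable_integrable ex(1) integrable_depth)
    also have "\<dots> = 2 * (\<Sum>j\<in>{1..<i}. expectation (?f j))"
      by (subst integral_mult_right_zero, subst Bochner_Integration.integral_sum) (auto intro: ex(1))
    also have "(\<Sum>j\<in>{1..<i}. expectation (?f j)) = (\<Sum>j\<in>{1..<i}. real j / (real i - 1))"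
      by (intro sum.cong refl ex(2))
    also have "(\<Sum>j\<in>{1..<i}. real j / (real i - 1)) = real (\<Sum>j\<in>{0..<i}. j) / (real i - 1)"
      using i by (subst sum.atLeast_Suc_lessThan) (auto simp: sum_divide_distrib)
    also have "\<dots> = real i / 2"
      using i by (simp add: Sum_Ico_nat real_of_nat_div of_nat_diff field_simps)
    finally show ?thesis by simp
  qed
qed

lemma AE_depth_bound:
  "AE \<omega> in M. \<exists>C. \<forall>i\<ge>1. 2 ^ node_depth i \<omega> \<le> C * real i ^ 3"
proof -
  let ?Y = "\<lambda>i \<omega>. 2 ^ node_depth (Suc i) \<omega> / real (Suc i) ^ 3 :: real"
  have "expectation (?Y i) = inverse (real (Suc i) ^ 2)" for i
  proof -
    have "expectation (?Y i) = real (Suc i) / real (Suc i) ^ 3"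
      using expectation_depth[of "Suc i"] by (simp del: of_nat_Suc)
    then show ?thesis
      by (simp add: power3_eq_cube power2_eq_square inverse_eq_divide del: of_nat_Suc)
  qed
  moreover have "summable (\<lambda>i. inverse (real (Suc i) ^ 2))"
    using inverse_power_summable[of 2, where 'a = real] by (subst summable_Suc_iff) simp
  ultimately have "AE \<omega> in M. \<exists>C. \<forall>i. ?Y i \<omega> \<le> C"
    by (intro AE_bounded_of_summable_integral) (auto intro!: integrable_divide integrable_depth)
  then show ?thesis
  proof eventually_elim
    case (elim \<omega>)
    then obtain C where C: "\<And>i. ?Y i \<omega> \<le> C" by blast
    have "2 ^ node_depth i \<omega> \<le> C * real i ^ 3" if "1 \<le> i" for i
      using C[of "i - 1"] that by (simp add: field_simps)
    then show ?case by blast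
  qed
qed

section \<open>Size of the displacements\<close>

lemma AE_step_bound:
  assumes "\<alpha> > 0"
  shows "AE \<omega> in M. \<exists>C. \<forall>i\<ge>2. \<bar>\<delta> i k \<omega>\<bar> \<le> C * real i powr (- \<alpha> / 2)"
proof -
  obtain m :: nat where m: "1 < real m * \<alpha>"
    using assms reals_Archimedean3 by blast
  then have "m \<noteq> 0" by (intro notI) simp
  \<comment> \<open>Half of the decay exponent \<open>\<alpha>\<close> is given up to make a high moment summable.\<close>
  let ?s = "\<lambda>i. real i powr (\<alpha> / 2)"
  let ?Y = "\<lambda>i \<omega>. (?s i * \<delta> i k \<omega>) ^ (2 * m)"
  define K :: real where "K = fact (2 * m) / (2 ^ m * fact m)"
  have Y: "integrable M (?Y i)" "expectation (?Y i) = K * real i powr (- (real m * \<alpha>))"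
    if i: "2 \<le> i" for i
  proof -
    let ?\<sigma> = "real i powr (- \<alpha>)"
    have "fact (2 * m) / ((2 / ?\<sigma>\<^sup>2) ^ m * fact m) = K * ?\<sigma> ^ (2 * m)"
      by (simp add: K_def power_divide power_mult)
    with normal_moment_even[of ?\<sigma> 0 m] i have mom: "has_bochner_integral lborel (\<lambda>x. normal_density 0 ?\<sigma> x * x ^ (2 * m)) (K * ?\<sigma> ^ (2 * m))"
      by simp
    have "integrable M (\<lambda>\<omega>. \<delta> i k \<omega> ^ (2 * m))"
      using distributed_integrable[OF step_normal[OF i, of k], of "\<lambda>x. x ^ (2 * m)"] mom
      by (auto simp: has_bochner_integral_iff)
    then show "integrable M (?Y i)"
      by (simp add: power_mult_distrib)
    have "expectation (\<lambda>\<omega>. \<delta> i k \<omega> ^ (2 * m)) = K * ?\<sigma> ^ (2 * m)"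
      using distributed_integral[OF step_normal[OF i, of k], of "\<lambda>x. x ^ (2 * m)"] mom
      by (auto simp: has_bochner_integral_iff)
    then have "expectation (?Y i) = K * (?s i * ?\<sigma>) ^ (2 * m)"
      by (simp add: power_mult_distrib)
    also have "(?s i * ?\<sigma>) ^ (2 * m) = real i powr (- (real m * \<alpha>))"
      using i by (simp add: powr_add[symmetric] powr_power algebra_simps)
    finally show "expectation (?Y i) = K * real i powr (- (real m * \<alpha>))" .
  qed
  have "summable (\<lambda>i. real i powr (- (real m * \<alpha>)))"
    using m by (subst summable_real_powr_iff) simp
  then have "summable (\<lambda>i. K * real (i + 2) powr (- (real m * \<alpha>)))"
    by (intro summable_mult summable_ignore_initial_segment)
  then have "AE \<omega> in M. \<exists>C. \<forall>i. ?Y (i + 2) \<omega> \<le> C"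
    by (intro AE_bounded_of_summable_integral) (simp_all only: Y le_add2 zero_le_even_power even_mult_iff even_numeral simp_thms)
  then show ?thesis
  proof eventually_elim
    case (elim \<omega>)
    then obtain C where C: "\<And>i. ?Y (i + 2) \<omega> \<le> C" by blast
    have "\<bar>\<delta> i k \<omega>\<bar> \<le> (1 + C) * real i powr (- \<alpha> / 2)" if i: "2 \<le> i" for i
    proof -
      let ?y = "?s i * \<delta> i k \<omega>"
      have yC: "?y ^ (2 * m) \<le> C" using C[of "i - 2"] i by (simp only: le_add_diff_inverse2)
      have "\<bar>?y\<bar> \<le> 1 + ?y ^ (2 * m)"
      proof (cases "\<bar>?y\<bar> \<le> 1")
        case True
        then show ?thesis by (simp add: power_mult add_increasing2)
      next
        case False
        then have "\<bar>?y\<bar> ^ 1 \<le> \<bar>?y\<bar> ^ (2 * m)"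
          using \<open>m \<noteq> 0\<close> by (intro power_increasing) auto
        then show ?thesis by (simp add: power_even_abs)
      qed
      with yC have "?s i * \<bar>\<delta> i k \<omega>\<bar> \<le> 1 + C" by (simp add: abs_mult)
      with i show ?thesis by (simp add: powr_minus field_simps)
    qed
    then show ?case by blast
  qed
qed

section \<open>Summation along ancestral lines\<close>

lemma AE_coordinate_bounded:
  assumes "\<alpha> > 0"
  shows "AE \<omega> in M. \<exists>C. \<forall>i\<ge>1. \<bar>X i \<omega> $ k\<bar> \<le> C"
proof -
  have "AE \<omega> in M. \<forall>i\<in>{2..}. 1 \<le> J i \<omega> \<and> J i \<omega> < i"
    using AE_parent by (subst AE_ball_countable) auto
  with AE_depth_bound AE_step_bound[OF assms, of k] AE_space
  show ?thesis
  proof eventually_elim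
    case (elim \<omega>)
    let ?D = "\<lambda>i. node_depth i \<omega>"
    obtain C1 where C1: "\<And>i. 1 \<le> i \<Longrightarrow> 2 ^ ?D i \<le> C1 * real i ^ 3"
      using elim(1) by blast
    obtain C2 where C2: "\<And>i. 2 \<le> i \<Longrightarrow> \<bar>\<delta> i k \<omega>\<bar> \<le> C2 * real i powr (- \<alpha> / 2)"
      using elim(2) by blast
    have J: "1 \<le> J i \<omega>" "J i \<omega> < i" if "2 \<le> i" for i
      using elim(4) that by auto
    have "0 < C1"
      using C1[of 1] by (simp add: depth_root)
    have "0 \<le> C2 * real 2 powr (- \<alpha> / 2)"
      using C2[of 2] by (meson abs_ge_zero order.refl order.trans)
    then have "0 \<le> C2"
      by (simp add: zero_le_mult_iff)
    define r where "r = 2 powr (- \<alpha> / 6)"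
    define B where "B = C2 * C1 powr (\<alpha> / 6)"
    have r: "0 < r" "r < 1"
      using assms by (auto simp: r_def powr_less_one)
    have "0 \<le> B"
      using \<open>0 \<le> C2\<close> by (simp add: B_def)
    have step: "\<bar>\<delta> i k \<omega>\<bar> \<le> B * r ^ ?D i" if i: "2 \<le> i" for i
    proof -
      \<comment> \<open>The depth bound, raised to the power that turns \<open>i ^ 3\<close> into \<open>i powr (\<alpha> / 2)\<close>.\<close>
      have "(2 ^ ?D i / C1) powr (\<alpha> / 6) \<le> (real i ^ 3) powr (\<alpha> / 6)"
        using C1[of i] i \<open>0 < C1\<close> assms by (intro powr_mono2) (auto simp: field_simps)
      also have "(real i ^ 3) powr (\<alpha> / 6) = real i powr (\<alpha> / 2)"
        using i by (simp add: powr_powr flip: powr_numeral)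
      finally have "inverse (real i powr (\<alpha> / 2)) \<le> inverse ((2 ^ ?D i / C1) powr (\<alpha> / 6))"
        using \<open>0 < C1\<close> by (intro le_imp_inverse_le) auto
      also have "\<dots> = C1 powr (\<alpha> / 6) * inverse ((2 ^ ?D i) powr (\<alpha> / 6))"
        using \<open>0 < C1\<close> by (simp add: powr_divide field_simps)
      also have "inverse ((2 ^ ?D i) powr (\<alpha> / 6)) = r ^ ?D i"
        by (simp add: r_def powr_power powr_powr mult.commute flip: powr_realpow powr_minus)
      finally have "real i powr (- \<alpha> / 2) \<le> C1 powr (\<alpha> / 6) * r ^ ?D i"
        by (simp add: powr_minus)
      then have "C2 * real i powr (- \<alpha> / 2) \<le> B * r ^ ?D i"
        unfolding B_def mult.assoc using \<open>0 \<le> C2\<close> by (rule mult_left_mono)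
      with C2[OF i] show ?thesis by simp
    qed
    have path: "\<bar>X i \<omega> $ k\<bar> \<le> B * (\<Sum>n\<le>?D i. r ^ n)" if "1 \<le> i" for i
      using that
    proof (induction i rule: less_induct)
      case (less i)
      show ?case
      proof (cases "i = 1")
        case True
        then show ?thesis
          using X_first[OF elim(3)] \<open>0 \<le> B\<close> r by (simp add: sum_nonneg)
      next
        case False
        with less.prems have i: "2 \<le> i" by simp
        have "\<bar>X i \<omega> $ k\<bar> \<le> \<bar>X (J i \<omega>) \<omega> $ k\<bar> + \<bar>\<delta> i k \<omega>\<bar>"
          using X_step[OF i elim(3)] by simp
        also have "\<dots> \<le> B * (\<Sum>n\<le>?D (J i \<omega>). r ^ n) + B * r ^ ?D i"
          using less.IH[of "J i \<omega>"] J[OF i] step[OF i] by (intro add_mono) auto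
        also have "\<dots> = B * (\<Sum>n\<le>?D i. r ^ n)"
          using J[OF i] i by (simp add: depth_step algebra_simps)
        finally show ?thesis .
      qed
    qed
    have "(\<Sum>n\<le>N. r ^ n) \<le> 1 / (1 - r)" for N
      using sum_le_suminf[of "\<lambda>n. r ^ n" "{..N}"] r by (simp add: suminf_geometric summable_geometric)
    then have "\<bar>X i \<omega> $ k\<bar> \<le> B * (1 / (1 - r))" if "1 \<le> i" for i
      using path[OF that] \<open>0 \<le> B\<close> by (meson mult_left_mono order.trans)
    then show ?case by blast
  qed
qed

end

theorem mainTheorem3:
  fixes M :: "'a measure"
    and \<alpha> :: real
    and J :: "nat \<Rightarrow> 'a \<Rightarrow> nat"
    and \<delta> :: "nat \<Rightarrow> 'n::finite \<Rightarrow> 'a \<Rightarrow> real"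
    and X :: "nat \<Rightarrow> 'a \<Rightarrow> real ^ 'n"
  assumes "CARD('n) \<ge> 2"
    and "\<alpha> > 0"
    and "growing_cluster_process M \<alpha> J \<delta> X"
  shows "AE \<omega> in M. bounded (convex hull {X i \<omega> | i. i \<ge> 1})"
proof -
  interpret growing_cluster_process M \<alpha> J \<delta> X by fact
  have "AE \<omega> in M. \<forall>k. \<exists>C. \<forall>i\<ge>1. \<bar>X i \<omega> $ k\<bar> \<le> C"
    using AE_coordinate_bounded[OF \<open>\<alpha> > 0\<close>] by (simp add: AE_all_countable)
  then show ?thesis
  proof eventually_elim
    case (elim \<omega>)
    then obtain C where C: "\<And>k i. 1 \<le> i \<Longrightarrow> \<bar>X i \<omega> $ k\<bar> \<le> C k" by metis
    have "norm (X i \<omega>) \<le> (\<Sum>k\<in>UNIV. C k)" if "1 \<le> i" for i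
      by (rule order.trans[OF norm_le_l1_cart]) (intro sum_mono C that)
    then have "bounded {X i \<omega> | i. i \<ge> 1}"
      by (intro boundedI) auto
    then show ?case by (rule bounded_convex_hull)
  qed
qed

end
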